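(* Let $\varphi:\Sigma\to\Delta$ be a combinatorial morphism of posets and let $\mathcal V\subset\mathcal W\subset\Sigma$ be open sets. For $\alpha\in\mathcal W\setminus\mathcal V$ write $\mathcal U_{\varphi(\alpha)}=(\uparrow_\Delta\varphi(\alpha))\setminus\{\varphi(\alpha)\}$. If, for all $\alpha\in\mathcal W\setminus\mathcal V$, the set $\mathcal U_{\varphi(\alpha)}$ is connected and $\varphi^{-1}(\mathcal U_{\varphi(\alpha)})\subset\mathcal V$, then any balanced map $m_{\mathcal V}:\mathcal V\to\mathbb Z_{\ge1}$ extends to a balanced map $m_{\mathcal W}:\mathcal W\to\mathbb Z_{\ge1}$ by setting $$m_{\mathcal W}(\alpha)=\sum_{\gamma\in\varphi^{-1}(\beta),\ \alpha\lessdot\gamma}m_{\mathcal V}(\gamma)$$ for $\alpha\in\mathcal W\setminus\mathcal V$ and $\beta\in\Delta$ covering $\varphi(\alpha)$. The value is independent of the choice of $\beta$.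
   Context: Posets carry the topology whose open sets are the up-closed sets (up-sets); connectedness refers to this topology. $\uparrow_\Delta\beta=\{\gamma\in\Delta:\beta\le\gamma\}$, $\downarrow_\Sigma\alpha=\{\gamma\in\Sigma:\gamma\le\alpha\}$. $\alpha\lessdot\gamma$ means $\gamma$ covers $\alpha$ ($\alpha<\gamma$ with no element strictly between). A morphism of posets is an order-preserving map; $\varphi:\Sigma\to\Delta$ is combinatorial if $\Sigma,\Delta$ are finite and, for all $\alpha\in\Sigma$, $\varphi$ maps $\downarrow_\Sigma\alpha$ isomorphically onto $\downarrow_\Delta\varphi(\alpha)$. For an up-set $\mathcal V\subset\Sigma$, a map $m_{\mathcal V}:\mathcal V\to\mathbb Z_{\ge1}$ is balanced (with respect to $\varphi$) if for every $\alpha\in\mathcal V$ and every $\beta\in\Delta$ with $\varphi(\alpha)\lessdot\beta$ one has $m_{\mathcal V}(\alpha)=\sum_{\gamma\in\varphi^{-1}(\beta),\ \alpha\lessdot\gamma}m_{\mathcal V}(\gamma)$ (empty sums are $0$).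
   Formalization: As stated, the values of m_W can be 0 (Σ={a}, Δ={0<1}, φ(a)=0, V=∅, W=Σ). Formal version: independence of β and balancing equations always hold; m_W ≥ 1 exactly when each α in W∖V whose image has a cover in Δ has a cover in Σ. *)

theory Defs
  imports "HOL-Analysis.Abstract_Topology"
begin

text \<open>A poset is a carrier set inside a type of class \<open>order\<close>. All notions are relative to the
  carrier.\<close>

definition up_set :: "'a::order set \<Rightarrow> 'a set \<Rightarrow> bool" where
  "up_set P U \<longleftrightarrow> U \<subseteq> P \<and> (\<forall>x\<in>U. \<forall>y\<in>P. x \<le> y \<longrightarrow> y \<in> U)"

definition poset_topology :: "'a::order set \<Rightarrow> 'a topology" where
  "poset_topology P = topology (up_set P)"

lemma istopology_up_set: "istopology (up_set P)"
  unfolding istopology_def up_set_def by blast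

lemma openin_poset_topology: "openin (poset_topology P) U \<longleftrightarrow> up_set P U"
  unfolding poset_topology_def by (simp add: istopology_up_set topology_inverse')

lemma topspace_poset_topology: "topspace (poset_topology P) = P"
  unfolding topspace_def openin_poset_topology up_set_def by blast

definition up_of :: "'a::order set \<Rightarrow> 'a \<Rightarrow> 'a set" where
  "up_of P x = {y \<in> P. x \<le> y}"

definition down_of :: "'a::order set \<Rightarrow> 'a \<Rightarrow> 'a set" where
  "down_of P x = {y \<in> P. y \<le> x}"

definition covered_by :: "'a::order set \<Rightarrow> 'a \<Rightarrow> 'a \<Rightarrow> bool" where
  "covered_by P x y \<longleftrightarrow> x \<in> P \<and> y \<in> P \<and> x < y \<and> (\<forall>z\<in>P. \<not> (x < z \<and> z < y))"

definition poset_morphism :: "'a::order set \<Rightarrow> 'b::order set \<Rightarrow> ('a \<Rightarrow> 'b) \<Rightarrow> bool" where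
  "poset_morphism P Q f \<longleftrightarrow> f ` P \<subseteq> Q \<and> mono_on P f"

definition poset_iso :: "'a::order set \<Rightarrow> 'b::order set \<Rightarrow> ('a \<Rightarrow> 'b) \<Rightarrow> bool" where
  "poset_iso P Q f \<longleftrightarrow> bij_betw f P Q \<and> (\<forall>x\<in>P. \<forall>y\<in>P. x \<le> y \<longleftrightarrow> f x \<le> f y)"

definition combinatorial :: "'a::order set \<Rightarrow> 'b::order set \<Rightarrow> ('a \<Rightarrow> 'b) \<Rightarrow> bool" where
  "combinatorial P Q f \<longleftrightarrow> finite P \<and> finite Q \<and> poset_morphism P Q f \<and>
     (\<forall>x\<in>P. poset_iso (down_of P x) (down_of Q (f x)) f)"

definition cover_sum :: "'a::order set \<Rightarrow> ('a \<Rightarrow> 'b) \<Rightarrow> ('a \<Rightarrow> nat) \<Rightarrow> 'a \<Rightarrow> 'b \<Rightarrow> nat" where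
  "cover_sum P f m x b = (\<Sum>y \<in> {y \<in> P. f y = b \<and> covered_by P x y}. m y)"

definition balancing_equations ::
  "'a::order set \<Rightarrow> 'b::order set \<Rightarrow> ('a \<Rightarrow> 'b) \<Rightarrow> 'a set \<Rightarrow> ('a \<Rightarrow> nat) \<Rightarrow> bool" where
  "balancing_equations P Q f V m \<longleftrightarrow>
     (\<forall>x\<in>V. \<forall>b. covered_by Q (f x) b \<longrightarrow> m x = cover_sum P f m x b)"

text \<open>The domain \<open>V\<close> is meant to be an up-set of \<open>P\<close>: then \<open>cover_sum\<close> only uses values
  of \<open>m\<close> on \<open>V\<close>, and the values of \<open>m\<close> outside \<open>V\<close> are irrelevant.\<close>

definition balanced ::
  "'a::order set \<Rightarrow> 'b::order set \<Rightarrow> ('a \<Rightarrow> 'b) \<Rightarrow> 'a set \<Rightarrow> ('a \<Rightarrow> nat) \<Rightarrow> bool" where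
  "balanced P Q f V m \<longleftrightarrow> (\<forall>x\<in>V. m x \<ge> 1) \<and> balancing_equations P Q f V m"

text \<open>The open set \<open>\<U>\<^sub>b\<close> of elements strictly above \<open>b\<close>.\<close>

definition strict_up :: "'a::order set \<Rightarrow> 'a \<Rightarrow> 'a set" where
  "strict_up P b = up_of P b - {b}"

end

theory Submission
  imports Defs
begin

text \<open>
  Fix \<open>x \<in> W - V\<close>. For \<open>b\<close> strictly above \<open>\<phi> x\<close> let \<open>F b\<close> be the sum of \<open>m\<^sub>V\<close> over \<^emph>\<open>all\<close>
  elements of \<open>\<Sigma>\<close> over \<open>b\<close> that lie above \<open>x\<close>, not only over covers of \<open>x\<close>. Unlike the sum
  over covers, \<open>F\<close> can be compared along the whole strict up-set of \<open>\<phi> x\<close>, and it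
  agrees with the sum over covers when \<open>b\<close> covers \<open>\<phi> x\<close>. Independence of the choice of
  \<open>\<beta>\<close> thus follows once \<open>F\<close> is constant.

  If \<open>c\<close> covers \<open>b\<close>, then \<open>F b = F c\<close> (\<open>fiber_sum_cover\<close>): every element over \<open>c\<close> and above \<open>x\<close>
  dominates exactly one element over \<open>b\<close>, which is again above \<open>x\<close>, because \<open>\<phi>\<close> identifies
  principal down-sets; so the elements counted by \<open>F c\<close> are partitioned according to the elements
  counted by \<open>F b\<close>, and the balancing equations evaluate the sum over each block. In a finite
  poset comparable elements are joined by a chain of covers, so \<open>F\<close> takes equal values at
  comparable elements. Its level sets are then open, and connectedness makes \<open>F\<close> constant
  (\<open>connectedin_poset_topology_constant\<close>).

  The values of the extension are these common sums, and the balancing equations hold because only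
  values on \<open>V\<close> enter them. What can fail is positivity: the common sum is positive exactly if it
  is nonempty, and an element above which \<open>\<Sigma>\<close> has no cover gives an empty sum. Since \<open>\<phi>\<close>
  sends covers to covers, this is the only obstruction.
\<close>

section \<open>Covers and connectedness in posets\<close>

lemma finite_le_imp_covered_by_chain:
  assumes "finite P" "x \<in> P" "y \<in> P" "x \<le> y"
  shows "(covered_by P)\<^sup>*\<^sup>* x y"
  using assms(2,4)
proof (induction "card {z \<in> P. x < z \<and> z \<le> y}" arbitrary: x rule: less_induct)
  case less
  let ?I = "{z \<in> P. x < z \<and> z \<le> y}"
  show ?case
  proof (cases "x = y")
    case False
    then have "y \<in> ?I" using less.prems assms(3) by auto
    moreover have fin: "finite ?I" using assms(1) by simp
    ultimately obtain z where z: "z \<in> ?I" and min: "\<And>w. w \<in> ?I \<Longrightarrow> w \<le> z \<Longrightarrow> w = z"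
      using finite_has_minimal[of ?I] by blast
    have cov: "covered_by P x z"
      unfolding covered_by_def
    proof (intro conjI ballI notI)
      fix w assume "w \<in> P" "x < w \<and> w < z"
      moreover from this have "w \<le> y" using z by (auto dest: order.strict_trans2)
      ultimately show False using min[of w] by (auto dest: less_imp_le)
    qed (use z less.prems in auto)
    have "{w \<in> P. z < w \<and> w \<le> y} \<subset> ?I" using z by auto
    then have "(covered_by P)\<^sup>*\<^sup>* z y"
      using less.hyps[of z] psubset_card_mono[OF fin] z by auto
    with cov show ?thesis by (rule converse_rtranclp_into_rtranclp)
  qed simp
qed

text \<open>A function that cannot change along the order has level sets that are up-sets, as are the
  complements of these within the up-set, so each level set is open and closed.\<close>

lemma connectedin_poset_topology_constant:
  assumes U: "up_set P U" and conn: "connectedin (poset_topology P) U"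
    and F: "\<And>x y. x \<in> U \<Longrightarrow> y \<in> U \<Longrightarrow> x \<le> y \<Longrightarrow> F x = F y"
    and "a \<in> U" "b \<in> U"
  shows "F a = F b"
proof (rule ccontr)
  assume ne: "F a \<noteq> F b"
  let ?A = "{x \<in> U. F x = F a}" and ?B = "{x \<in> U. F x \<noteq> F a}"
  have stay: "y \<in> U \<and> F y = F x" if "x \<in> U" "y \<in> P" "x \<le> y" for x y
    using U F[of x y] that unfolding up_set_def by auto
  have "up_set P ?A" "up_set P ?B"
    using U stay unfolding up_set_def by auto
  then have "openin (poset_topology P) ?A" "openin (poset_topology P) ?B"
    by (simp_all add: openin_poset_topology)
  moreover have "U \<subseteq> ?A \<union> ?B" "?A \<inter> ?B \<inter> U = {}" "?A \<inter> U \<noteq> {}" "?B \<inter> U \<noteq> {}"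
    using assms(4,5) ne by auto
  ultimately show False
    using conn unfolding connectedin by blast
qed

lemma up_set_strict_up: "up_set P (strict_up P a)"
  unfolding up_set_def strict_up_def up_of_def by auto

lemma covered_by_in_strict_up: "covered_by P a b \<Longrightarrow> b \<in> strict_up P a"
  unfolding covered_by_def strict_up_def up_of_def by auto

section \<open>Combinatorial morphisms\<close>

lemma combinatorial_maps_to: "combinatorial P Q f \<Longrightarrow> x \<in> P \<Longrightarrow> f x \<in> Q"
  unfolding combinatorial_def poset_morphism_def by blast

lemma combinatorial_le_iff:
  assumes "combinatorial P Q f" "x \<in> P" "y \<in> P" "z \<in> P" "x \<le> z" "y \<le> z"
  shows "x \<le> y \<longleftrightarrow> f x \<le> f y"
proof -
  have "x \<in> down_of P z" "y \<in> down_of P z"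
    using assms by (simp_all add: down_of_def)
  then show ?thesis
    using assms(1,4) unfolding combinatorial_def poset_iso_def by blast
qed

lemma combinatorial_less_iff:
  assumes "combinatorial P Q f" "x \<in> P" "y \<in> P" "z \<in> P" "x \<le> z" "y \<le> z"
  shows "x < y \<longleftrightarrow> f x < f y"
  using combinatorial_le_iff[OF assms] combinatorial_le_iff[OF assms(1,3,2,4,6,5)]
  by (simp add: less_le_not_le)

lemma combinatorial_eq_iff:
  assumes "combinatorial P Q f" "x \<in> P" "y \<in> P" "z \<in> P" "x \<le> z" "y \<le> z"
  shows "x = y \<longleftrightarrow> f x = f y"
  using combinatorial_le_iff[OF assms] combinatorial_le_iff[OF assms(1,3,2,4,6,5)]
  by (simp add: order_eq_iff)

lemma combinatorial_lift:
  assumes "combinatorial P Q f" "z \<in> P" "b \<in> Q" "b \<le> f z"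
  obtains y where "y \<in> P" "y \<le> z" "f y = b"
proof -
  have "bij_betw f (down_of P z) (down_of Q (f z))"
    using assms(1,2) unfolding combinatorial_def poset_iso_def by blast
  then have "f ` down_of P z = down_of Q (f z)"
    by (rule bij_betw_imp_surj_on)
  then have "b \<in> f ` down_of P z"
    using assms(3,4) by (simp add: down_of_def)
  then show ?thesis using that unfolding down_of_def by auto
qed

text \<open>The interval between \<open>x\<close> and \<open>y\<close> lies in the principal down-set of \<open>y\<close>, and \<open>f\<close> carries it
  isomorphically to the interval between the images.\<close>

lemma combinatorial_covered_by_iff:
  assumes c: "combinatorial P Q f" and P: "x \<in> P" "y \<in> P" and le: "x \<le> y"
  shows "covered_by P x y \<longleftrightarrow> covered_by Q (f x) (f y)"
proof -
  have less: "x < y \<longleftrightarrow> f x < f y"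
    using combinatorial_less_iff[OF c P(1,2,2) le] by simp
  have "(\<exists>z\<in>P. x < z \<and> z < y) \<longleftrightarrow> (\<exists>b\<in>Q. f x < b \<and> b < f y)"
  proof
    assume "\<exists>z\<in>P. x < z \<and> z < y"
    then obtain z where "z \<in> P" "x < z" "z < y" by blast
    then show "\<exists>b\<in>Q. f x < b \<and> b < f y"
      using combinatorial_less_iff[OF c P(1) _ P(2) le, of z]
        combinatorial_less_iff[OF c _ P(2,2), of z] combinatorial_maps_to[OF c]
      by (intro bexI[of _ "f z"]) auto
  next
    assume "\<exists>b\<in>Q. f x < b \<and> b < f y"
    then obtain b where b: "b \<in> Q" "f x < b" "b < f y" by blast
    then obtain z where "z \<in> P" "z \<le> y" "f z = b"
      using combinatorial_lift[OF c P(2)] by (metis less_imp_le)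
    then show "\<exists>z\<in>P. x < z \<and> z < y"
      using combinatorial_less_iff[OF c P(1) _ P(2) le, of z]
        combinatorial_less_iff[OF c _ P(2,2), of z] b
      by (intro bexI[of _ z]) auto
  qed
  then show ?thesis
    using less P combinatorial_maps_to[OF c] unfolding covered_by_def by blast
qed

section \<open>Sums over fibers\<close>

definition fiber_sum :: "'a::order set \<Rightarrow> ('a \<Rightarrow> 'b) \<Rightarrow> ('a \<Rightarrow> nat) \<Rightarrow> 'a \<Rightarrow> 'b \<Rightarrow> nat" where
  "fiber_sum P f m x b = (\<Sum>y \<in> {y \<in> P. f y = b \<and> x \<le> y}. m y)"

lemma cover_sum_eq_fiber_sum:
  assumes "combinatorial P Q f" "x \<in> P" "covered_by Q (f x) b"
  shows "cover_sum P f m x b = fiber_sum P f m x b"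
proof -
  have "{y \<in> P. f y = b \<and> covered_by P x y} = {y \<in> P. f y = b \<and> x \<le> y}"
    using combinatorial_covered_by_iff[OF assms(1,2)] assms(3)
    by (auto simp: covered_by_def less_imp_le)
  then show ?thesis unfolding cover_sum_def fiber_sum_def by simp
qed

text \<open>Summing the balancing equations over the elements counted on the left counts each element
  over \<open>c\<close> and above \<open>x\<close> exactly once, namely at its unique lower bound over \<open>b\<close>.\<close>

lemma fiber_sum_cover:
  assumes comb: "combinatorial P Q f" and bal: "balancing_equations P Q f V m"
    and x: "x \<in> P" and bc: "covered_by Q b c" and xb: "f x \<le> b"
    and V: "{y \<in> P. f y = b \<and> x \<le> y} \<subseteq> V"
  shows "fiber_sum P f m x b = fiber_sum P f m x c"
proof -
  let ?I = "{y \<in> P. f y = b \<and> x \<le> y}"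
  let ?A = "\<lambda>y. {z \<in> P. f z = c \<and> covered_by P y z}"
  have finP: "finite P" using comb unfolding combinatorial_def by blast
  have "?A y \<inter> ?A y' = {}" if "y \<in> ?I" "y' \<in> ?I" "y \<noteq> y'" for y y'
  proof -
    have False if "z \<in> ?A y" "z \<in> ?A y'" for z
      using combinatorial_eq_iff[OF comb, of y y' z] that \<open>y \<in> ?I\<close> \<open>y' \<in> ?I\<close> \<open>y \<noteq> y'\<close>
      by (auto simp: covered_by_def less_imp_le)
    then show ?thesis by blast
  qed
  then have disj: "\<forall>y\<in>?I. \<forall>y'\<in>?I. y \<noteq> y' \<longrightarrow> ?A y \<inter> ?A y' = {}" by blast
  have union: "(\<Union>y\<in>?I. ?A y) = {z \<in> P. f z = c \<and> x \<le> z}"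
  proof
    show "(\<Union>y\<in>?I. ?A y) \<subseteq> {z \<in> P. f z = c \<and> x \<le> z}"
      by (auto simp: covered_by_def)
  next
    show "{z \<in> P. f z = c \<and> x \<le> z} \<subseteq> (\<Union>y\<in>?I. ?A y)"
    proof
      fix z assume "z \<in> {z \<in> P. f z = c \<and> x \<le> z}"
      then have z: "z \<in> P" "f z = c" "x \<le> z" by auto
      obtain y where y: "y \<in> P" "y \<le> z" "f y = b"
        using combinatorial_lift[OF comb z(1), of b] bc z(2)
        by (auto simp: covered_by_def less_imp_le)
      have "x \<le> y"
        using combinatorial_le_iff[OF comb x y(1) z(1,3) y(2)] xb y(3) by simp
      moreover have "covered_by P y z"
        using combinatorial_covered_by_iff[OF comb y(1) z(1) y(2)] bc y(3) z(2) by simp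
      ultimately show "z \<in> (\<Union>y\<in>?I. ?A y)" using y z by auto
    qed
  qed
  have "fiber_sum P f m x b = (\<Sum>y\<in>?I. \<Sum>z\<in>?A y. m z)"
    unfolding fiber_sum_def
  proof (rule sum.cong)
    fix y assume "y \<in> ?I"
    then show "m y = (\<Sum>z\<in>?A y. m z)"
      using bal V bc unfolding balancing_equations_def cover_sum_def by blast
  qed simp
  also have "\<dots> = sum m (\<Union>y\<in>?I. ?A y)"
    using finP disj by (subst sum.UNION_disjoint) auto
  finally show ?thesis by (simp only: union fiber_sum_def)
qed

lemma fiber_sum_eq_of_le:
  assumes comb: "combinatorial P Q f" and bal: "balancing_equations P Q f V m"
    and x: "x \<in> P" and V: "{y \<in> P. f y \<in> strict_up Q (f x)} \<subseteq> V"
    and b: "b \<in> strict_up Q (f x)" and c: "c \<in> Q" and le: "b \<le> c"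
  shows "fiber_sum P f m x b = fiber_sum P f m x c"
proof -
  have "finite Q" using comb unfolding combinatorial_def by blast
  then have "(covered_by Q)\<^sup>*\<^sup>* b c"
    using finite_le_imp_covered_by_chain b c le by (auto simp: strict_up_def up_of_def)
  then have "c \<in> strict_up Q (f x) \<and> fiber_sum P f m x b = fiber_sum P f m x c"
  proof induction
    case base
    then show ?case using b by simp
  next
    case (step u v)
    have "v \<in> strict_up Q (f x)"
      using up_set_strict_up[of Q "f x"] step unfolding up_set_def covered_by_def
      by (meson less_imp_le)
    moreover have "fiber_sum P f m x u = fiber_sum P f m x v"
    proof (rule fiber_sum_cover[OF comb bal x step.hyps(2)])
      show "f x \<le> u" using step.IH by (simp add: strict_up_def up_of_def)
      show "{y \<in> P. f y = u \<and> x \<le> y} \<subseteq> V" using V step.IH by auto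
    qed
    ultimately show ?case using step.IH by simp
  qed
  then show ?thesis by simp
qed

lemma cover_sum_independent:
  assumes comb: "combinatorial P Q f" and bal: "balancing_equations P Q f V m"
    and x: "x \<in> P" and V: "{y \<in> P. f y \<in> strict_up Q (f x)} \<subseteq> V"
    and conn: "connectedin (poset_topology Q) (strict_up Q (f x))"
    and b: "covered_by Q (f x) b" and c: "covered_by Q (f x) c"
  shows "cover_sum P f m x b = cover_sum P f m x c"
proof -
  have "fiber_sum P f m x b = fiber_sum P f m x c"
  proof (rule connectedin_poset_topology_constant[OF up_set_strict_up conn])
    fix u v assume "u \<in> strict_up Q (f x)" "v \<in> strict_up Q (f x)" "u \<le> v"
    then show "fiber_sum P f m x u = fiber_sum P f m x v"
      using fiber_sum_eq_of_le[OF comb bal x V] by (simp add: strict_up_def up_of_def)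
  qed (use b c in \<open>simp_all add: covered_by_in_strict_up\<close>)
  then show ?thesis using cover_sum_eq_fiber_sum[OF comb x] b c by simp
qed

lemma cover_sum_cong:
  assumes "\<And>y. y \<in> P \<Longrightarrow> f y = b \<Longrightarrow> x \<le> y \<Longrightarrow> m y = m' y"
  shows "cover_sum P f m x b = cover_sum P f m' x b"
  unfolding cover_sum_def using assms by (intro sum.cong) (auto simp: covered_by_def)

section \<open>Extension of balanced maps\<close>

theorem mainTheorem4:
  fixes \<Sigma> :: "'a::order set" and \<Delta> :: "'b::order set" and \<phi> :: "'a \<Rightarrow> 'b"
    and V W :: "'a set" and m\<^sub>V :: "'a \<Rightarrow> nat"
  assumes "combinatorial \<Sigma> \<Delta> \<phi>"
    and "openin (poset_topology \<Sigma>) V" and "openin (poset_topology \<Sigma>) W" and "V \<subseteq> W"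
    and "\<forall>\<alpha>\<in>W - V. connectedin (poset_topology \<Delta>) (strict_up \<Delta> (\<phi> \<alpha>))"
    and "\<forall>\<alpha>\<in>W - V. {\<gamma> \<in> \<Sigma>. \<phi> \<gamma> \<in> strict_up \<Delta> (\<phi> \<alpha>)} \<subseteq> V"
    and "balanced \<Sigma> \<Delta> \<phi> V m\<^sub>V"
  shows "(\<forall>\<alpha>\<in>W - V. \<forall>\<beta> \<beta>'. covered_by \<Delta> (\<phi> \<alpha>) \<beta> \<and> covered_by \<Delta> (\<phi> \<alpha>) \<beta>' \<longrightarrow>
            cover_sum \<Sigma> \<phi> m\<^sub>V \<alpha> \<beta> = cover_sum \<Sigma> \<phi> m\<^sub>V \<alpha> \<beta>') \<and>
         (\<exists>m\<^sub>W :: 'a \<Rightarrow> nat.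
            (\<forall>\<alpha>\<in>V. m\<^sub>W \<alpha> = m\<^sub>V \<alpha>) \<and>
            (\<forall>\<alpha>\<in>W - V. \<forall>\<beta>. covered_by \<Delta> (\<phi> \<alpha>) \<beta> \<longrightarrow> m\<^sub>W \<alpha> = cover_sum \<Sigma> \<phi> m\<^sub>V \<alpha> \<beta>) \<and>
            balancing_equations \<Sigma> \<Delta> \<phi> W m\<^sub>W \<and>
            (balanced \<Sigma> \<Delta> \<phi> W m\<^sub>W \<longleftrightarrow>
               (\<forall>\<alpha>\<in>W - V. (\<exists>\<beta>. covered_by \<Delta> (\<phi> \<alpha>) \<beta>) \<longrightarrow> (\<exists>\<gamma>. covered_by \<Sigma> \<alpha> \<gamma>))))"
proof -
  note comb = assms(1)
  have upV: "up_set \<Sigma> V" and WS: "W \<subseteq> \<Sigma>"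
    using assms(2,3) by (auto simp: openin_poset_topology up_set_def)
  have finS: "finite \<Sigma>" using comb unfolding combinatorial_def by blast
  have pos: "m\<^sub>V \<gamma> \<ge> 1" if "\<gamma> \<in> V" for \<gamma>
    using assms(7) that unfolding balanced_def by blast
  have bal: "balancing_equations \<Sigma> \<Delta> \<phi> V m\<^sub>V"
    using assms(7) unfolding balanced_def by blast
  have above: "\<gamma> \<in> V" if "\<alpha> \<in> W - V" "\<gamma> \<in> \<Sigma>" "covered_by \<Delta> (\<phi> \<alpha>) (\<phi> \<gamma>)" for \<alpha> \<gamma>
    using assms(6) that covered_by_in_strict_up by blast
  have indep: "cover_sum \<Sigma> \<phi> m\<^sub>V \<alpha> \<beta> = cover_sum \<Sigma> \<phi> m\<^sub>V \<alpha> \<beta>'"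
    if "\<alpha> \<in> W - V" "covered_by \<Delta> (\<phi> \<alpha>) \<beta>" "covered_by \<Delta> (\<phi> \<alpha>) \<beta>'" for \<alpha> \<beta> \<beta>'
  proof (rule cover_sum_independent[OF comb bal _ _ _ that(2,3)])
    show "\<alpha> \<in> \<Sigma>" using that(1) WS by blast
  qed (use that(1) assms(5,6) in simp_all)
  \<comment> \<open>Over a maximal element of \<open>\<Delta>\<close> there is no equation to satisfy; the value \<open>1\<close> keeps the
    map positive.\<close>
  define m where "m \<alpha> = (if \<alpha> \<in> V then m\<^sub>V \<alpha>
      else if \<exists>\<beta>. covered_by \<Delta> (\<phi> \<alpha>) \<beta>
      then cover_sum \<Sigma> \<phi> m\<^sub>V \<alpha> (SOME \<beta>. covered_by \<Delta> (\<phi> \<alpha>) \<beta>) else 1)" for \<alpha>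
  have mV: "m \<alpha> = m\<^sub>V \<alpha>" if "\<alpha> \<in> V" for \<alpha>
    using that by (simp add: m_def)
  have mW: "m \<alpha> = cover_sum \<Sigma> \<phi> m\<^sub>V \<alpha> \<beta>"
    if "\<alpha> \<in> W - V" "covered_by \<Delta> (\<phi> \<alpha>) \<beta>" for \<alpha> \<beta>
    using indep[OF that(1) someI that(2)] that by (auto simp: m_def)
  have "m \<alpha> = cover_sum \<Sigma> \<phi> m \<alpha> \<beta>" if "\<alpha> \<in> W" "covered_by \<Delta> (\<phi> \<alpha>) \<beta>" for \<alpha> \<beta>
  proof -
    have "m \<alpha> = cover_sum \<Sigma> \<phi> m\<^sub>V \<alpha> \<beta>"
      using mW[of \<alpha> \<beta>] mV[of \<alpha>] bal that unfolding balancing_equations_def by auto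
    also have "\<dots> = cover_sum \<Sigma> \<phi> m \<alpha> \<beta>"
    proof (rule cover_sum_cong)
      fix \<gamma> assume "\<gamma> \<in> \<Sigma>" "\<phi> \<gamma> = \<beta>" "\<alpha> \<le> \<gamma>"
      then have "\<gamma> \<in> V"
        using above[of \<alpha> \<gamma>] upV that unfolding up_set_def by blast
      then show "m\<^sub>V \<gamma> = m \<gamma>" by (simp add: mV)
    qed
    finally show ?thesis .
  qed
  then have eqs: "balancing_equations \<Sigma> \<Delta> \<phi> W m"
    unfolding balancing_equations_def by blast
  have pos_iff: "m \<alpha> \<ge> 1 \<longleftrightarrow> ((\<exists>\<beta>. covered_by \<Delta> (\<phi> \<alpha>) \<beta>) \<longrightarrow> (\<exists>\<gamma>. covered_by \<Sigma> \<alpha> \<gamma>))"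
    if \<alpha>: "\<alpha> \<in> W - V" for \<alpha>
  proof (intro iffI impI)
    assume "m \<alpha> \<ge> 1" and "\<exists>\<beta>. covered_by \<Delta> (\<phi> \<alpha>) \<beta>"
    then obtain \<beta> where \<beta>: "covered_by \<Delta> (\<phi> \<alpha>) \<beta>" by blast
    have "cover_sum \<Sigma> \<phi> m\<^sub>V \<alpha> \<beta> \<noteq> 0"
      using mW[OF \<alpha> \<beta>] \<open>m \<alpha> \<ge> 1\<close> by simp
    then obtain \<gamma> where "\<gamma> \<in> {\<gamma> \<in> \<Sigma>. \<phi> \<gamma> = \<beta> \<and> covered_by \<Sigma> \<alpha> \<gamma>}"
      unfolding cover_sum_def by (meson sum.not_neutral_contains_not_neutral)
    then show "\<exists>\<gamma>. covered_by \<Sigma> \<alpha> \<gamma>" by blast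
  next
    assume imp: "(\<exists>\<beta>. covered_by \<Delta> (\<phi> \<alpha>) \<beta>) \<longrightarrow> (\<exists>\<gamma>. covered_by \<Sigma> \<alpha> \<gamma>)"
    show "m \<alpha> \<ge> 1"
    proof (cases "\<exists>\<beta>. covered_by \<Delta> (\<phi> \<alpha>) \<beta>")
      case True
      then obtain \<gamma> where \<gamma>: "covered_by \<Sigma> \<alpha> \<gamma>" using imp by blast
      then have S: "\<alpha> \<in> \<Sigma>" "\<gamma> \<in> \<Sigma>" "\<alpha> \<le> \<gamma>" by (auto simp: covered_by_def)
      \<comment> \<open>Since the sums agree for all covers of \<open>\<phi> \<alpha>\<close>, the image of a
        cover of \<open>\<alpha>\<close> may be used, and the sum over it is nonempty.\<close>
      have cov: "covered_by \<Delta> (\<phi> \<alpha>) (\<phi> \<gamma>)"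
        using combinatorial_covered_by_iff[OF comb S] \<gamma> by simp
      have "1 \<le> m\<^sub>V \<gamma>" using pos above[OF \<alpha> S(2) cov] by simp
      also have "m\<^sub>V \<gamma> \<le> cover_sum \<Sigma> \<phi> m\<^sub>V \<alpha> (\<phi> \<gamma>)"
        unfolding cover_sum_def using finS S \<gamma> by (intro member_le_sum) auto
      finally show ?thesis using mW[OF \<alpha> cov] by simp
    next
      case False
      then show ?thesis using \<alpha> by (auto simp: m_def)
    qed
  qed
  have "balanced \<Sigma> \<Delta> \<phi> W m \<longleftrightarrow>
      (\<forall>\<alpha>\<in>W - V. (\<exists>\<beta>. covered_by \<Delta> (\<phi> \<alpha>) \<beta>) \<longrightarrow> (\<exists>\<gamma>. covered_by \<Sigma> \<alpha> \<gamma>))"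
  proof -
    have "balanced \<Sigma> \<Delta> \<phi> W m \<longleftrightarrow> (\<forall>\<alpha>\<in>W - V. m \<alpha> \<ge> 1)"
      using eqs pos mV assms(4) unfolding balanced_def by auto
    also have "\<dots> \<longleftrightarrow> (\<forall>\<alpha>\<in>W - V. (\<exists>\<beta>. covered_by \<Delta> (\<phi> \<alpha>) \<beta>) \<longrightarrow> (\<exists>\<gamma>. covered_by \<Sigma> \<alpha> \<gamma>))"
      using pos_iff by (rule ball_cong[OF refl])
    finally show ?thesis .
  qed
  then show ?thesis
    using mV mW eqs
    by (intro conjI exI[of _ m] ballI allI impI; (elim conjE)?) (rule indep | blast)+
qed

end
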